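(* For any positive integers $k,n$, $$\chi_{kcf}(H_n)=\lfloor \log_{k+1} n \rfloor + 1.$$
   Context: For a positive integer $n$, let $H_n=(V_n,\mathcal{E}_n)$ be the hypergraph with vertex set $V_n=\{1,2,\dots,n\}$ and hyperedge set $\mathcal{E}_n$ consisting of all non-empty subsets of $V_n$ made of consecutive integers, i.e. all sets $\{i,i+1,\dots,j\}$ with $1\le i\le j\le n$. For a positive integer $k$, a coloring $\phi:V\to\{1,\ldots,m\}$ of a hypergraph $H=(V,\mathcal{E})$ is called a $k$-CF-coloring ($k$-conflict-free coloring) if for every $e\in\mathcal{E}$ there is a color $j$ such that $1\leq |\{v\in e : \phi(v)=j\}|\leq k$. The chromatic number $\chi_{kcf}(H)$ is the smallest number of colors in any $k$-CF-coloring of $H$. $\lfloor x\rfloor$ denotes the largest integer that is less than or equal to $x$. *)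

theory Defs
  imports Complex_Main "HOL-Library.FuncSet"
begin

type_synonym 'a hypergraph = "'a set \<times> 'a set set"

definition is_kcf_coloring :: "nat \<Rightarrow> 'a hypergraph \<Rightarrow> nat \<Rightarrow> ('a \<Rightarrow> nat) \<Rightarrow> bool" where
  "is_kcf_coloring k H m \<phi> \<longleftrightarrow>
     \<phi> \<in> fst H \<rightarrow> {1..m} \<and>
     (\<forall>e\<in>snd H. \<exists>j\<in>{1..m}. 1 \<le> card {v \<in> e. \<phi> v = j} \<and> card {v \<in> e. \<phi> v = j} \<le> k)"

(* LEAST is meaningful only if some k-CF-coloring exists; for k \<ge> 1 and a finite vertex set
   with non-empty hyperedges, an injective coloring is one. *)
definition chi_kcf :: "nat \<Rightarrow> 'a hypergraph \<Rightarrow> nat" where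
  "chi_kcf k H = (LEAST m. \<exists>\<phi>. is_kcf_coloring k H m \<phi>)"

definition interval_hypergraph :: "nat \<Rightarrow> nat hypergraph" where
  "interval_hypergraph n = ({1..n}, {{i..j} | i j. 1 \<le> i \<and> i \<le> j \<and> j \<le> n})"

end

theory Submission
  imports Defs "HOL-Computational_Algebra.Primes"
begin

text \<open>
  Both bounds come from one equivalence: the hypergraph on \<open>n\<close> points has a \<open>k\<close>-conflict-free
  coloring with \<open>m\<close> colors iff \<open>n < (k + 1) ^ m\<close>. The least such \<open>m\<close> is the number of
  digits of \<open>n\<close> in base \<open>k + 1\<close>.

  For the lower bound, the interval of all points has a color \<open>j\<close> that occurs at most \<open>k\<close> times.
  The points of color \<open>j\<close> cut the interval into at most \<open>k + 1\<close> gaps, each of them colored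
  conflict-freely with the remaining colors. By induction each gap has fewer than
  \<open>(k + 1) ^ (m - 1)\<close> points, so the whole interval has fewer than \<open>(k + 1) ^ m\<close>.

  For the upper bound, color \<open>v\<close> by the exponent of \<open>k + 1\<close> in \<open>v\<close> (the ruler sequence).
  In an interval, the largest exponent \<open>t\<close> occurs at most \<open>k\<close> times, because among \<open>k + 1\<close>
  consecutive multiples of \<open>(k + 1) ^ t\<close> one is a multiple of \<open>(k + 1) ^ (t + 1)\<close>.
\<close>

text \<open>
  Stated with strict bounds, the estimate composes without error terms: two half-open pieces with
  fewer than \<open>P\<close> and fewer than \<open>Q\<close> points, together with the cut point between them, have fewer
  than \<open>P + Q\<close> points.
\<close>

lemma interval_length_less_if_gaps_less:
  fixes a b P :: nat
  assumes "finite X" and "X \<subseteq> {a..<b}" and "0 < P"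
    and "\<And>c d. a \<le> c \<Longrightarrow> d \<le> b \<Longrightarrow> {c..<d} \<inter> X = {} \<Longrightarrow> d - c < P"
  shows "b - a < (card X + 1) * P"
  using assms
proof (induction "card X" arbitrary: X a)
  case 0
  then have "X = {}" by simp
  with "0.prems"(4)[of a b] show ?case by simp
next
  case (Suc p)
  define x where "x = Min X"
  have "X \<noteq> {}" using Suc.hyps(2) by auto
  then have x: "x \<in> X" "\<And>y. y \<in> X \<Longrightarrow> x \<le> y"
    using Suc.prems(1) by (simp_all add: x_def)
  have cardX: "card (X - {x}) = p"
    using Suc.hyps(2) Suc.prems(1) x(1) by simp
  have range: "a \<le> x" "x < b" using x(1) Suc.prems(2) by auto
  have "b - Suc x < (card (X - {x}) + 1) * P"
  proof (rule Suc.hyps(1))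
    show "p = card (X - {x})" using cardX by simp
    show "finite (X - {x})" using Suc.prems(1) by simp
    show "X - {x} \<subseteq> {Suc x..<b}"
    proof
      fix y assume "y \<in> X - {x}"
      then show "y \<in> {Suc x..<b}" using x(2)[of y] Suc.prems(2) by auto
    qed
    show "0 < P" by fact
    fix c d assume cd: "Suc x \<le> c" "d \<le> b" "{c..<d} \<inter> (X - {x}) = {}"
    then have "{c..<d} \<inter> X = {}" by auto
    then show "d - c < P" using Suc.prems(4)[of c d] cd range by simp
  qed
  moreover have "x - a < P"
  proof (rule Suc.prems(4))
    show "{a..<x} \<inter> X = {}" using x(2) by force
  qed (use range in auto)
  ultimately have "b - a < P + (p + 1) * P"
    using range cardX by simp
  then show ?case using Suc.hyps(2)[symmetric] by simp
qed

text \<open>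
  The set of colors is arbitrary here, since the induction deletes whichever color is rare
  on the whole interval.
\<close>

lemma interval_length_less_if_conflict_free:
  fixes a b k :: nat and \<phi> :: "nat \<Rightarrow> 'c"
  assumes "finite C" and "\<And>v. v \<in> {a..<b} \<Longrightarrow> \<phi> v \<in> C"
    and "\<And>c d. a \<le> c \<Longrightarrow> c < d \<Longrightarrow> d \<le> b \<Longrightarrow>
      \<exists>j. 1 \<le> card {v \<in> {c..<d}. \<phi> v = j} \<and> card {v \<in> {c..<d}. \<phi> v = j} \<le> k"
  shows "b - a < (k + 1) ^ card C"
  using assms
proof (induction "card C" arbitrary: C a b)
  case 0
  then have "{a..<b} = {}" by fastforce
  then show ?case by simp
next
  case (Suc p)
  show ?case
  proof (cases "a < b")
    case False
    then show ?thesis by simp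
  next
    case True
    then obtain j where j: "1 \<le> card {v \<in> {a..<b}. \<phi> v = j}" "card {v \<in> {a..<b}. \<phi> v = j} \<le> k"
      using Suc.prems(3)[of a b] by blast
    define X where "X = {v \<in> {a..<b}. \<phi> v = j}"
    have "X \<noteq> {}" using j(1) unfolding X_def by (metis card.empty not_one_le_zero)
    then have "j \<in> C" using Suc.prems(2) by (auto simp: X_def)
    then have cardC: "p = card (C - {j})"
      using Suc.hyps(2) Suc.prems(1) by simp
    have "b - a < (card X + 1) * (k + 1) ^ p"
    proof (rule interval_length_less_if_gaps_less)
      fix c d assume cd: "a \<le> c" "d \<le> b" "{c..<d} \<inter> X = {}"
      have "d - c < (k + 1) ^ card (C - {j})"
      proof (rule Suc.hyps(1)[OF cardC])
        show "finite (C - {j})" using Suc.prems(1) by simp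
        show "\<phi> v \<in> C - {j}" if "v \<in> {c..<d}" for v
          using that cd Suc.prems(2)[of v] by (auto simp: X_def)
        show "\<exists>i. 1 \<le> card {v \<in> {c'..<d'}. \<phi> v = i} \<and> card {v \<in> {c'..<d'}. \<phi> v = i} \<le> k"
          if "c \<le> c'" "c' < d'" "d' \<le> d" for c' d'
          using that cd by (intro Suc.prems(3)) auto
      qed
      then show "d - c < (k + 1) ^ p" using cardC by simp
    qed (auto simp: X_def)
    also have "\<dots> \<le> (k + 1) * (k + 1) ^ p"
      using j(2) by (intro mult_right_mono) (auto simp: X_def)
    also have "\<dots> = (k + 1) ^ card C" using Suc.hyps(2)[symmetric] by simp
    finally show ?thesis .
  qed
qed

text \<open>
  The \<open>t\<close>-th base-\<open>b\<close> digit of a number of exact exponent \<open>t\<close> is nonzero, which leaves \<open>b - 1\<close>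
  values. Two such numbers with the same digit are separated by a multiple of \<open>b ^ (t + 1)\<close>, whose
  exponent is larger; so the digit determines the number when \<open>t\<close> is the largest exponent present.
\<close>

lemma card_maximal_multiplicity_le:
  fixes b i j t :: nat
  assumes b: "2 \<le> b" and i: "1 \<le> i"
    and max: "\<And>v. v \<in> {i..j} \<Longrightarrow> multiplicity b v \<le> t"
  shows "card {v \<in> {i..j}. multiplicity b v = t} \<le> b - 1"
proof -
  define S where "S = {v \<in> {i..j}. multiplicity b v = t}"
  have no_higher: "\<not> b ^ Suc t dvd v" if "v \<in> {i..j}" for v
  proof
    assume "b ^ Suc t dvd v"
    then have "Suc t \<le> multiplicity b v"
      using b i that by (intro multiplicity_geI) auto
    then show False using max[OF that] by simp
  qed
  have eq: "b ^ t * (v div b ^ t) = v" if "v \<in> S" for v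
    using that multiplicity_dvd[of b v] by (auto simp: S_def)
  have "inj_on (\<lambda>v. v div b ^ t mod b) S"
  proof (rule linorder_inj_onI')
    fix v w assume vw: "v \<in> S" "w \<in> S" "v < w"
    show "v div b ^ t mod b \<noteq> w div b ^ t mod b"
    proof
      assume same: "v div b ^ t mod b = w div b ^ t mod b"
      define v' where "v' = v div b ^ t"
      define w' where "w' = w div b ^ t"
      have v: "v = b ^ t * v'" and w: "w = b ^ t * w'"
        using eq vw by (auto simp: v'_def w'_def)
      have "v' < w'" using vw(3) v w by simp
      have split: "v' = b * (v' div b) + v' mod b" "w' = b * (w' div b) + w' mod b" by simp_all
      have "v' mod b = w' mod b" using same by (simp add: v'_def w'_def)
      then have "b * (v' div b) < b * (w' div b)" using split \<open>v' < w'\<close> by linarith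
      then have "Suc (v' div b) \<le> w' div b" by simp
      then have "b * Suc (v' div b) \<le> b * (w' div b)" by (rule mult_le_mono2)
      moreover have "v' mod b < b" using b by simp
      ultimately have "v' \<le> b * (w' div b)" using split(1) unfolding mult_Suc_right by linarith
      moreover have "b * (w' div b) \<le> w'" by simp
      ultimately have "v \<le> b ^ t * (b * (w' div b))" "b ^ t * (b * (w' div b)) \<le> w"
        unfolding v w by (intro mult_le_mono2; simp)+
      then have "b ^ t * (b * (w' div b)) \<in> {i..j}" using vw by (auto simp: S_def)
      then have "\<not> b ^ Suc t dvd b ^ t * (b * (w' div b))" by (rule no_higher)
      then show False by (simp add: mult_dvd_mono mult.assoc[symmetric] mult.commute[of b])
    qed
  qed
  moreover have "(\<lambda>v. v div b ^ t mod b) ` S \<subseteq> {1..b - 1}"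
  proof (rule image_subsetI)
    fix v assume v: "v \<in> S"
    have "v div b ^ t mod b \<noteq> 0"
    proof
      assume "v div b ^ t mod b = 0"
      then have "b ^ t * b dvd b ^ t * (v div b ^ t)" by (intro mult_dvd_mono) auto
      then have "b ^ Suc t dvd v" using eq[OF v] by (simp add: mult.commute)
      then show False using no_higher v by (auto simp: S_def)
    qed
    moreover have "v div b ^ t mod b < b" using b by simp
    ultimately show "v div b ^ t mod b \<in> {1..b - 1}" by simp
  qed
  ultimately have "card S \<le> card {1..b - 1}" by (intro card_inj_on_le) auto
  then show ?thesis by (simp add: S_def)
qed

lemma ruler_coloring_is_kcf:
  fixes k n m :: nat
  assumes k: "1 \<le> k" and n: "n < (k + 1) ^ m"
  shows "is_kcf_coloring k (interval_hypergraph n) m (\<lambda>v. Suc (multiplicity (k + 1) v))"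
proof -
  let ?e = "multiplicity (k + 1)"
  have bound: "?e v < m" if "v \<in> {1..n}" for v
  proof -
    have "(k + 1) ^ ?e v \<le> v" using that by (intro dvd_imp_le multiplicity_dvd) auto
    also have "\<dots> < (k + 1) ^ m" using that n by simp
    finally show ?thesis using k by simp
  qed
  have "\<exists>c\<in>{1..m}. 1 \<le> card {v \<in> {i..j}. Suc (?e v) = c} \<and> card {v \<in> {i..j}. Suc (?e v) = c} \<le> k"
    if ij: "1 \<le> i" "i \<le> j" "j \<le> n" for i j
  proof -
    define t where "t = Max (?e ` {i..j})"
    have "t \<in> ?e ` {i..j}" unfolding t_def using ij by (intro Max_in) auto
    then obtain w where w: "w \<in> {i..j}" "?e w = t" by auto
    have "card {v \<in> {i..j}. ?e v = t} \<le> (k + 1) - 1"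
      using k ij by (intro card_maximal_multiplicity_le) (auto simp: t_def)
    moreover have "{v \<in> {i..j}. ?e v = t} \<noteq> {}" using w by blast
    then have "1 \<le> card {v \<in> {i..j}. ?e v = t}" by (simp add: Suc_le_eq card_gt_0_iff)
    moreover have "Suc t \<in> {1..m}" using bound[of w] w ij by auto
    ultimately show ?thesis by (intro bexI[of _ "Suc t"]) auto
  qed
  then show ?thesis
    using bound by (auto simp: is_kcf_coloring_def interval_hypergraph_def Suc_le_eq)
qed

lemma kcf_coloring_imp_less:
  fixes k n m :: nat
  assumes "is_kcf_coloring k (interval_hypergraph n) m \<phi>"
  shows "n < (k + 1) ^ m"
proof -
  have "Suc n - 1 < (k + 1) ^ card {1..m}"
  proof (rule interval_length_less_if_conflict_free[where \<phi> = \<phi>])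
    show "\<phi> v \<in> {1..m}" if "v \<in> {1..<Suc n}" for v
      using assms that by (auto simp: is_kcf_coloring_def interval_hypergraph_def Pi_iff)
    show "\<exists>j. 1 \<le> card {v \<in> {c..<d}. \<phi> v = j} \<and> card {v \<in> {c..<d}. \<phi> v = j} \<le> k"
      if "1 \<le> c" "c < d" "d \<le> Suc n" for c d
    proof -
      have "{c..<d} = {c..d - 1}" "c \<le> d - 1" "d - 1 \<le> n" using that by auto
      then have "{c..<d} \<in> snd (interval_hypergraph n)"
        using that(1) unfolding interval_hypergraph_def by auto
      then show ?thesis using assms unfolding is_kcf_coloring_def by blast
    qed
  qed simp
  then show ?thesis by simp
qed

theorem theorem3p1:
  fixes k n :: nat
  assumes "k \<ge> 1" and "n \<ge> 1"
  shows "int (chi_kcf k (interval_hypergraph n)) = \<lfloor>log (real (k + 1)) (real n)\<rfloor> + 1"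
proof -
  have colorable_iff: "(\<exists>\<phi>. is_kcf_coloring k (interval_hypergraph n) m \<phi>) \<longleftrightarrow> n < (k + 1) ^ m" for m
    using ruler_coloring_is_kcf[OF assms(1)] kcf_coloring_imp_less by blast
  have "0 \<le> log (real (k + 1)) (real n)" using assms by simp
  then obtain l where l: "\<lfloor>log (real (k + 1)) (real n)\<rfloor> = int l"
    by (metis zero_le_floor nonneg_int_cases)
  then have digits: "(k + 1) ^ l \<le> n" "n < (k + 1) ^ (l + 1)"
    using assms floor_log_nat_eq_powr_iff[of "k + 1" n l] by auto
  have "chi_kcf k (interval_hypergraph n) = l + 1"
    unfolding chi_kcf_def colorable_iff
  proof (rule Least_equality)
    show "n < (k + 1) ^ (l + 1)" by fact
    fix m assume "n < (k + 1) ^ m"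
    with digits(1) have "(k + 1) ^ l < (k + 1) ^ m" by linarith
    then show "l + 1 \<le> m" using assms(1) by simp
  qed
  then show ?thesis using l by simp
qed

end
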